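(* For $n=2$ and $r=9$, there exists an $\mathrm{SL}_2(\mathbb{Z})$ equivariant and translation invariant valuation $\mathrm{N}:\mathcal{P}(\mathbb{Z}^2)\to\mathbb{T}^9$ which is not a linear combination (with real coefficients) of the Ehrhart tensors $\mathrm{L}^9_1,\dots,\mathrm{L}^9_{11}$.
   Context: $\mathbb{N}_0=\{0,1,2,\dots\}$. $\mathcal{P}(\mathbb{Z}^2)$ is the set of lattice polygons in $\mathbb{R}^2$, i.e. convex polytopes with vertices in $\mathbb{Z}^2$ (the empty set, points and segments included). $\mathbb{T}^9$ is the vector space of symmetric tensors of rank $9$ on $\mathbb{R}^2$, identified via the scalar product with symmetric $9$-linear functionals on $(\mathbb{R}^2)^9$. For $x\in\mathbb{R}^2$, $x^9\in\mathbb{T}^9$ is given by $x^9(v_1,\dots,v_9)=(x\cdot v_1)\cdots(x\cdot v_9)$. A function $\mathrm{Z}:\mathcal{P}(\mathbb{Z}^2)\to\mathbb{T}^9$ is: a valuation if $\mathrm{Z}(\emptyset)=0$ and $\mathrm{Z}(P)+\mathrm{Z}(Q)=\mathrm{Z}(P\cup Q)+\mathrm{Z}(P\cap Q)$ whenever $P,Q,P\cup Q,P\cap Q\in\mathcal{P}(\mathbb{Z}^2)$; $\mathrm{SL}_2(\mathbb{Z})$ equivariant if $\mathrm{Z}(\phi P)(v_1,\dots,v_9)=\mathrm{Z}(P)(\phi^t v_1,\dots,\phi^t v_9)$ for all $v_1,\dots,v_9\in\mathbb{R}^2$, $\phi\in\mathrm{SL}_2(\mathbb{Z})$ (integer matrices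 of determinant $1$), $P\in\mathcal{P}(\mathbb{Z}^2)$, where $\phi^t$ is the transpose; translation invariant if $\mathrm{Z}(P+y)=\mathrm{Z}(P)$ for all $y\in\mathbb{Z}^2$ and $P\in\mathcal{P}(\mathbb{Z}^2)$. The discrete moment tensor of rank $9$ is $\mathrm{L}^9(P)=\frac1{9!}\sum_{x\in P\cap\mathbb{Z}^2}x^9$. The Ehrhart tensors $\mathrm{L}^9_i:\mathcal{P}(\mathbb{Z}^2)\to\mathbb{T}^9$, $i=1,\dots,11$, are the coefficients (which exist and are unique) in $\mathrm{L}^9(kP)=\sum_{i=1}^{11}\mathrm{L}^9_i(P)k^i$ for all $k\in\mathbb{N}_0$ and $P\in\mathcal{P}(\mathbb{Z}^2)$. *)

theory Defs
  imports "HOL-Analysis.Analysis"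
begin

definition lattice_points :: "(real^'n) set" where
  "lattice_points = {x. \<forall>i. x $ i \<in> \<int>}"

text \<open>The empty set is a polytope and has no extreme points, so it is a lattice polytope.\<close>

definition lattice_polytope :: "(real^'n) set \<Rightarrow> bool" where
  "lattice_polytope P \<longleftrightarrow> polytope P \<and> {x. x extreme_point_of P} \<subseteq> lattice_points"

text \<open>
  The tensor rank is the cardinality of the index type \<open>'r\<close>: tensors are the symmetric
  functionals on families \<open>'r \<Rightarrow> real^'n\<close> that are linear in each argument.
\<close>

definition multilinear :: "(('r \<Rightarrow> real^'n) \<Rightarrow> real) \<Rightarrow> bool" where
  "multilinear T \<longleftrightarrow> (\<forall>v i. linear (\<lambda>x. T (v(i := x))))"

definition symmetric :: "(('r \<Rightarrow> 'v) \<Rightarrow> real) \<Rightarrow> bool" where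
  "symmetric T \<longleftrightarrow> (\<forall>v \<pi>. bij \<pi> \<longrightarrow> T (v \<circ> \<pi>) = T v)"

typedef (overloaded) ('n, 'r) sym_tensor =
  "{T :: ('r \<Rightarrow> real^'n) \<Rightarrow> real. multilinear T \<and> symmetric T}"
  morphisms tensor_apply Abs_sym_tensor
proof
  show "(\<lambda>_. 0) \<in> {T :: ('r \<Rightarrow> real^'n) \<Rightarrow> real. multilinear T \<and> symmetric T}"
    by (auto simp: multilinear_def symmetric_def linear_iff)
qed

setup_lifting type_definition_sym_tensor

instantiation sym_tensor :: (finite, type) real_vector
begin

lift_definition zero_sym_tensor :: "('a, 'b) sym_tensor" is "\<lambda>_. 0"
  by (auto simp: multilinear_def symmetric_def linear_iff)

lift_definition plus_sym_tensor ::
  "('a, 'b) sym_tensor \<Rightarrow> ('a, 'b) sym_tensor \<Rightarrow> ('a, 'b) sym_tensor"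
  is "\<lambda>S T v. S v + T v"
  by (auto simp: multilinear_def symmetric_def linear_iff algebra_simps)

lift_definition minus_sym_tensor ::
  "('a, 'b) sym_tensor \<Rightarrow> ('a, 'b) sym_tensor \<Rightarrow> ('a, 'b) sym_tensor"
  is "\<lambda>S T v. S v - T v"
  by (auto simp: multilinear_def symmetric_def linear_iff algebra_simps)

lift_definition uminus_sym_tensor :: "('a, 'b) sym_tensor \<Rightarrow> ('a, 'b) sym_tensor"
  is "\<lambda>T v. - T v"
  by (auto simp: multilinear_def symmetric_def linear_iff)

lift_definition scaleR_sym_tensor :: "real \<Rightarrow> ('a, 'b) sym_tensor \<Rightarrow> ('a, 'b) sym_tensor"
  is "\<lambda>c T v. c * T v"
  by (auto simp: multilinear_def symmetric_def linear_iff algebra_simps)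

instance
  by standard (transfer; force simp: algebra_simps)+

end

lift_definition tensor_power :: "real^'n \<Rightarrow> ('n, 'r::finite) sym_tensor"
  is "\<lambda>x v. \<Prod>i\<in>UNIV. x \<bullet> v i"
proof
  fix x :: "real^'n"
  show "multilinear (\<lambda>v :: 'r \<Rightarrow> real^'n. \<Prod>i\<in>UNIV. x \<bullet> v i)"
    unfolding multilinear_def
  proof (intro allI)
    fix v :: "'r \<Rightarrow> real^'n" and i :: 'r
    have "(\<Prod>j\<in>UNIV. x \<bullet> (v(i := y)) j) = (x \<bullet> y) * (\<Prod>j\<in>UNIV - {i}. x \<bullet> v j)" for y
      by (subst prod.remove[of _ i]) (auto intro!: prod.cong)
    then show "linear (\<lambda>y. \<Prod>j\<in>UNIV. x \<bullet> (v(i := y)) j)"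
      by (simp add: linear_iff inner_add_right algebra_simps)
  qed
  show "symmetric (\<lambda>v :: 'r \<Rightarrow> real^'n. \<Prod>i\<in>UNIV. x \<bullet> v i)"
    unfolding symmetric_def
  proof (intro allI impI)
    fix v :: "'r \<Rightarrow> real^'n" and \<pi> :: "'r \<Rightarrow> 'r"
    assume "bij \<pi>"
    then show "(\<Prod>i\<in>UNIV. x \<bullet> (v \<circ> \<pi>) i) = (\<Prod>i\<in>UNIV. x \<bullet> v i)"
      using prod.reindex_bij_betw[of \<pi> UNIV UNIV "\<lambda>i. x \<bullet> v i"] by simp
  qed
qed

definition valuation :: "((real^'n) set \<Rightarrow> 'a::ab_group_add) \<Rightarrow> bool" where
  "valuation Z \<longleftrightarrow> Z {} = 0 \<and>
    (\<forall>P Q. lattice_polytope P \<and> lattice_polytope Q \<and>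
        lattice_polytope (P \<union> Q) \<and> lattice_polytope (P \<inter> Q) \<longrightarrow>
      Z P + Z Q = Z (P \<union> Q) + Z (P \<inter> Q))"

definition SL_Z :: "(real^'n^'n) set" where
  "SL_Z = {\<phi>. (\<forall>i j. \<phi> $ i $ j \<in> \<int>) \<and> det \<phi> = 1}"

definition SL_Z_equivariant :: "((real^'n) set \<Rightarrow> ('n, 'r) sym_tensor) \<Rightarrow> bool" where
  "SL_Z_equivariant Z \<longleftrightarrow> (\<forall>\<phi>\<in>SL_Z. \<forall>P. lattice_polytope P \<longrightarrow>
    (\<forall>v. tensor_apply (Z ((\<lambda>x. \<phi> *v x) ` P)) v =
         tensor_apply (Z P) (\<lambda>i. transpose \<phi> *v v i)))"

definition translation_invariant :: "((real^'n) set \<Rightarrow> 'a) \<Rightarrow> bool" where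
  "translation_invariant Z \<longleftrightarrow> (\<forall>y\<in>lattice_points. \<forall>P. lattice_polytope P \<longrightarrow>
    Z ((\<lambda>x. x + y) ` P) = Z P)"

definition discrete_moment_tensor :: "(real^'n) set \<Rightarrow> ('n, 'r::finite) sym_tensor" where
  "discrete_moment_tensor P =
    (1 / fact CARD('r)) *\<^sub>R (\<Sum>x\<in>P \<inter> lattice_points. tensor_power x)"

text \<open>
  The coefficient of \<open>k ^ i\<close> in the expansion of the discrete moment tensor of \<open>k P\<close>; meaningful
  for lattice polytopes \<open>P\<close> and \<open>1 \<le> i \<le> CARD('n) + CARD('r)\<close>. The sequence \<open>c\<close> is
  unconstrained outside this range, so only the entry \<open>c i\<close> is determined.
\<close>

definition ehrhart_tensor :: "nat \<Rightarrow> (real^'n) set \<Rightarrow> ('n, 'r::finite) sym_tensor" where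
  "ehrhart_tensor i P = (THE T. \<exists>c :: nat \<Rightarrow> ('n, 'r) sym_tensor. T = c i \<and>
    (\<forall>k::nat. discrete_moment_tensor ((\<lambda>x. real k *\<^sub>R x) ` P) =
      (\<Sum>j = 1..CARD('n) + CARD('r). real k ^ j *\<^sub>R c j)))"

end

theory Submission
  imports Defs "HOL-Computational_Algebra.Polynomial"
begin

text \<open>
  Walk counterclockwise around the boundary of a lattice polygon \<open>P\<close>, stopping at every lattice
  point; for each step from \<open>x\<close> to \<open>y\<close> add the power \<open>(y - x) ^ r\<close>. The resulting tensor
  \<open>boundary_tensor P\<close> depends on \<open>P\<close> only through the differences of its points, the lattice and the
  orientation of the plane, so it is invariant under translations and equivariant under
  \<open>SL\<^sub>2(\<int>)\<close>. It is a valuation because of an identity of sets of steps: the steps of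
  \<open>P \<union> Q\<close> and of \<open>P \<inter> Q\<close> together are those of \<open>P\<close> and of \<open>Q\<close> together, with the same
  multiplicities (\<open>boundary_steps_Un\<close>, \<open>boundary_steps_Int\<close>).

  A reflection of the plane reverses the walk. For odd \<open>r\<close> the boundary tensor therefore
  changes sign in comparison with an \<open>SL\<^sub>2(\<int>)\<close> equivariant valuation that is also equivariant
  under reflections, and the Ehrhart tensors are of the latter kind. To turn this into a
  contradiction it suffices to look at the triangle \<open>T\<close> with vertices \<open>0\<close>, \<open>e\<^sub>1\<close>, \<open>e\<^sub>2\<close>, which
  the exchange of coordinates maps to itself: all Ehrhart tensors of \<open>T\<close> are invariant under
  that exchange (\<open>ehrhart_tensor_std_triangle_swap_coords\<close>), whereas the boundary tensor of \<open>T\<close>, namely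
  \<open>e\<^sub>1 ^ 9 + (e\<^sub>2 - e\<^sub>1) ^ 9 + (- e\<^sub>2) ^ 9\<close>, changes sign and is not zero.

  Ehrhart tensors are defined by a definite description, so this argument needs the existence
  and uniqueness of the expansion of the moment tensor of \<open>k T\<close> in powers of \<open>k\<close>. Evaluated
  at fixed vectors, the moment is an iterated sum of monomials over \<open>i \<le> s \<le> k\<close>, hence
  polynomial in \<open>k\<close>; Lagrange interpolation, whose coefficients do not depend on the
  vectors, turns these polynomials into one with tensor coefficients
  (\<open>ehrhart_expansion_std_triangle\<close>).
\<close>

section \<open>Boundary steps of a lattice polygon\<close>

definition wedge :: "real^2 \<Rightarrow> real^2 \<Rightarrow> real" where
  "wedge u v = u $ 1 * v $ 2 - u $ 2 * v $ 1"

text \<open>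
  The sign condition on \<^const>\<open>wedge\<close> says that \<open>P\<close> lies to the left of the line from \<open>x\<close> to \<open>y\<close>.
  A segment with lattice end points has both orientations among its steps, so that its odd
  powers cancel.
\<close>

definition boundary_steps :: "(real^2) set \<Rightarrow> ((real^2) \<times> (real^2)) set" where
  "boundary_steps P = {(x, y). x \<in> P \<and> y \<in> P \<and> x \<noteq> y \<and>
     closed_segment x y \<inter> lattice_points = {x, y} \<and> (\<forall>z\<in>P. 0 \<le> wedge (y - x) (z - x))}"

definition boundary_tensor :: "(real^2) set \<Rightarrow> (2, 'r::finite) sym_tensor" where
  "boundary_tensor P = (\<Sum>(x, y)\<in>boundary_steps P. tensor_power (y - x))"

lemma tensor_apply_sum: "tensor_apply (\<Sum>x\<in>A. f x) v = (\<Sum>x\<in>A. tensor_apply (f x) v)"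
  by (induction A rule: infinite_finite_induct)
     (auto simp: zero_sym_tensor.rep_eq plus_sym_tensor.rep_eq)

lemma finite_bounded_lattice_points:
  fixes S :: "(real^'n) set"
  assumes "bounded S"
  shows "finite (S \<inter> lattice_points)"
proof -
  obtain B where B: "\<And>x. x \<in> S \<Longrightarrow> norm x \<le> B"
    using assms by (auto simp: bounded_iff)
  have "\<bar>x $ i\<bar> \<le> B" if "x \<in> S" for x i
    using B[OF that] component_le_norm_cart[of x i] by linarith
  then have "vec_nth ` (S \<inter> lattice_points) \<subseteq> PiE UNIV (\<lambda>_. {k\<in>\<int>. \<bar>k\<bar> \<le> B})"
    by (auto simp: lattice_points_def)
  moreover have "finite (PiE (UNIV :: 'n set) (\<lambda>_. {k\<in>\<int>. \<bar>k\<bar> \<le> B}))"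
    by (intro finite_PiE) (auto intro: finite_abs_int_segment)
  ultimately show ?thesis
    by (rule finite_imageD[OF finite_subset]) (auto simp: inj_on_def vec_nth_inject)
qed

lemma finite_boundary_steps:
  assumes "lattice_polytope P"
  shows "finite (boundary_steps P)"
proof (rule finite_subset)
  show "boundary_steps P \<subseteq> (P \<inter> lattice_points) \<times> (P \<inter> lattice_points)"
    by (auto simp: boundary_steps_def)
  have "bounded P"
    using assms by (auto simp: lattice_polytope_def polytope_imp_bounded)
  then show "finite ((P \<inter> lattice_points) \<times> (P \<inter> lattice_points))"
    by (simp add: finite_bounded_lattice_points)
qed

section \<open>The valuation property\<close>

text \<open>
  The segment is connected and covered by the two closed sets. This is the only way in which
  the convexity of the union is used.
\<close>

lemma segment_meets_Int:
  fixes P Q :: "'a::real_normed_vector set"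
  assumes "closed P" "closed Q" "convex (P \<union> Q)" "p \<in> P" "q \<in> Q"
  obtains z where "z \<in> closed_segment p q" "z \<in> P" "z \<in> Q"
proof -
  have sub: "closed_segment p q \<subseteq> P \<union> Q"
    using assms by (intro closed_segment_subset) auto
  have "connected (closed_segment p q)" by simp
  from this[unfolded connected_closed] assms sub
  have "P \<inter> Q \<inter> closed_segment p q \<noteq> {}"
    by (metis IntI ends_in_segment(1) ends_in_segment(2) empty_iff)
  with that show ?thesis by blast
qed

lemma wedge_altdef: "wedge u v = vector [- u $ 2, u $ 1] \<bullet> v"
  by (simp add: wedge_def inner_vec_def sum_2)

lemma wedge_affine:
  "wedge u ((1 - t) *\<^sub>R p + t *\<^sub>R q - x) = (1 - t) * wedge u (p - x) + t * wedge u (q - x)"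
  by (simp add: wedge_def algebra_simps)

lemma wedge_eq_0_imp_on_line:
  assumes "wedge (y - x) (z - x) = 0" "x \<noteq> y"
  obtains t where "z = x + t *\<^sub>R (y - x)"
proof -
  have eq: "(y $ 1 - x $ 1) * (z $ 2 - x $ 2) = (y $ 2 - x $ 2) * (z $ 1 - x $ 1)"
    using assms(1) by (simp add: wedge_def)
  have div: "q = p / a * b" if "a * q = b * p" "a \<noteq> 0" for a b p q :: real
    using that by (simp add: field_simps)
  from assms(2) have "y $ 1 - x $ 1 \<noteq> 0 \<or> y $ 2 - x $ 2 \<noteq> 0"
    by (auto simp: vec_eq_iff forall_2)
  then show ?thesis
  proof
    assume "y $ 1 - x $ 1 \<noteq> 0"
    with div[OF eq] have "z = x + ((z $ 1 - x $ 1) / (y $ 1 - x $ 1)) *\<^sub>R (y - x)"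
      by (simp add: vec_eq_iff forall_2 flip: diff_eq_eq)
    then show ?thesis by (rule that)
  next
    assume "y $ 2 - x $ 2 \<noteq> 0"
    with div[OF eq[symmetric]] have "z = x + ((z $ 2 - x $ 2) / (y $ 2 - x $ 2)) *\<^sub>R (y - x)"
      by (simp add: vec_eq_iff forall_2 flip: diff_eq_eq)
    then show ?thesis by (rule that)
  qed
qed

text \<open>
  The part of a polytope on a supporting line is a face, and its extreme points are vertices of
  the polytope, hence lattice points.
\<close>

lemma lattice_point_on_supporting_line:
  assumes R: "lattice_polytope R" and supp: "\<And>z. z \<in> R \<Longrightarrow> 0 \<le> wedge u (z - x)"
    and z: "z \<in> R" "wedge u (z - x) = 0"
  obtains w where "w \<in> R" "w \<in> lattice_points" "wedge u (w - x) = 0"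
proof -
  define a where "a = (vector [- u $ 2, u $ 1] :: real^2)"
  have a: "wedge u (z - x) = a \<bullet> z - a \<bullet> x" for z
    by (simp add: wedge_altdef a_def inner_diff_right)
  have conv: "convex R" and comp: "compact R"
    using R by (auto simp: lattice_polytope_def polytope_imp_convex polytope_imp_compact)
  define F where "F = R \<inter> {z. a \<bullet> z = a \<bullet> x}"
  have face: "F face_of R"
    unfolding F_def using supp conv
    by (intro face_of_Int_supporting_hyperplane_ge) (auto simp: a)
  have "compact F" "convex F"
    using face comp conv face_of_imp_compact face_of_imp_convex by blast+
  moreover have "F \<noteq> {}"
    using z by (auto simp: F_def a)
  ultimately obtain w where "w extreme_point_of F"
    using extreme_point_exists_convex by blast
  then have "w extreme_point_of R" "w \<in> F"
    using extreme_point_of_face[OF face] by auto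
  with R have "w \<in> lattice_points" "w \<in> R" "wedge u (w - x) = 0"
    by (auto simp: lattice_polytope_def F_def a)
  then show ?thesis using that by blast
qed

text \<open>
  A step of the union does not cross from one polygon to the other. The intersection
  would meet the step; being a lattice polygon, it then contains a lattice point
  on the same line, which cannot lie strictly between \<open>x\<close> and \<open>y\<close>. By convexity the end point
  nearer to it belongs to both polygons.
\<close>

lemma boundary_step_in_part:
  assumes P: "lattice_polytope P" and Q: "lattice_polytope Q"
    and U: "lattice_polytope (P \<union> Q)" and I: "lattice_polytope (P \<inter> Q)"
    and xy: "(x, y) \<in> boundary_steps (P \<union> Q)" and x: "x \<in> P" and y: "y \<in> Q"
  shows "y \<in> P \<or> x \<in> Q"
proof -
  have cl: "closed P" "closed Q" and conv: "convex P" "convex Q" "convex (P \<union> Q)"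
    using P Q U
    by (auto simp: lattice_polytope_def polytope_imp_closed polytope_imp_convex)
  obtain z where z: "z \<in> closed_segment x y" "z \<in> P" "z \<in> Q"
    using segment_meets_Int[OF cl conv(3) x y] .
  have "x \<noteq> y" and cons: "closed_segment x y \<inter> lattice_points = {x, y}"
    and supp: "\<And>z. z \<in> P \<union> Q \<Longrightarrow> 0 \<le> wedge (y - x) (z - x)"
    using xy by (auto simp: boundary_steps_def)
  from z(1) have "wedge (y - x) (z - x) = 0"
    by (auto simp: in_segment wedge_affine) (auto simp: wedge_def)
  with z supp I obtain w where
    w: "w \<in> P \<inter> Q" "w \<in> lattice_points" "wedge (y - x) (w - x) = 0"
    using lattice_point_on_supporting_line[of "P \<inter> Q" "y - x" x z] by blast
  from w(3) \<open>x \<noteq> y\<close> obtain t where t: "w = x + t *\<^sub>R (y - x)"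
    by (rule wedge_eq_0_imp_on_line)
  consider "t \<le> 0" | "0 < t" "t < 1" | "1 \<le> t" by linarith
  then show ?thesis
  proof cases
    case 1
    have "x = (1 - (- t / (1 - t))) *\<^sub>R w + (- t / (1 - t)) *\<^sub>R y"
    proof -
      have "(1 - t) *\<^sub>R x = w - t *\<^sub>R y"
        by (simp add: t algebra_simps)
      then have "x = (1 / (1 - t)) *\<^sub>R (w - t *\<^sub>R y)"
        using 1 by (metis diff_gt_0_iff_gt divide_self_if le_less_trans less_irrefl
            scaleR_one scaleR_scaleR times_divide_eq_left mult_1 zero_less_one)
      moreover have "1 - (- t / (1 - t)) = 1 / (1 - t)"
        using 1 by (simp add: field_simps)
      ultimately show ?thesis by (simp add: algebra_simps)
    qed
    moreover have "0 \<le> - t / (1 - t)" "- t / (1 - t) \<le> 1"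
      using 1 by (auto simp: field_simps)
    ultimately have "x \<in> closed_segment w y"
      unfolding in_segment by blast
    then show ?thesis
      using w(1) y conv(2) closed_segment_subset by blast
  next
    case 2
    then have "w \<in> closed_segment x y"
      unfolding in_segment t by (intro exI[of _ t]) (auto simp: algebra_simps)
    with w(2) cons have "w = x \<or> w = y" by blast
    with w(1) show ?thesis by blast
  next
    case 3
    have "y = (1 - 1 / t) *\<^sub>R x + (1 / t) *\<^sub>R w"
      using 3 by (simp add: t algebra_simps)
    moreover have "0 \<le> 1 / t" "1 / t \<le> 1"
      using 3 by auto
    ultimately have "y \<in> closed_segment x w"
      unfolding in_segment by blast
    then show ?thesis
      using w(1) x conv(1) closed_segment_subset by blast
  qed
qed

lemma boundary_steps_mono:
  assumes "(x, y) \<in> boundary_steps R" "P \<subseteq> R" "x \<in> P" "y \<in> P"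
  shows "(x, y) \<in> boundary_steps P"
  using assms by (auto simp: boundary_steps_def)

text \<open>
  A step of \<open>P \<inter> Q\<close> supports one of the polygons: a point of \<open>P\<close> and a point of \<open>Q\<close>
  strictly to its right would be joined by a segment that meets \<open>P \<inter> Q\<close> there. Conversely, if a
  step of \<open>P\<close> has a point \<open>q\<close> of \<open>Q\<close> strictly to its right, then the segment from a point of the
  step to \<open>q\<close> leaves \<open>P\<close> at once, so the step lies in \<open>Q\<close> as well.
\<close>

lemma boundary_steps_Un:
  assumes P: "lattice_polytope P" and Q: "lattice_polytope Q"
    and U: "lattice_polytope (P \<union> Q)" and I: "lattice_polytope (P \<inter> Q)"
  shows "boundary_steps (P \<union> Q) \<union> boundary_steps (P \<inter> Q) = boundary_steps P \<union> boundary_steps Q"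
proof (intro equalityI subsetI; clarify)
  fix x y
  assume "(x, y) \<in> boundary_steps (P \<union> Q) \<union> boundary_steps (P \<inter> Q)" "(x, y) \<notin> boundary_steps Q"
  then consider (U) "(x, y) \<in> boundary_steps (P \<union> Q)" | (I) "(x, y) \<in> boundary_steps (P \<inter> Q)"
    by blast
  then show "(x, y) \<in> boundary_steps P"
  proof cases
    case U
    have "x \<in> P \<union> Q" "y \<in> P \<union> Q"
      using U by (auto simp: boundary_steps_def)
    moreover have "y \<in> P \<or> x \<in> Q" if "x \<in> P" "y \<in> Q"
      using boundary_step_in_part[OF P Q assms(3) I U that] .
    moreover have "y \<in> Q \<or> x \<in> P" if "x \<in> Q" "y \<in> P"
      using boundary_step_in_part[of Q P x y] P Q assms(3) I U that by (simp add: Un_commute Int_commute)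
    ultimately have "x \<in> P \<and> y \<in> P \<or> x \<in> Q \<and> y \<in> Q"
      by blast
    then show ?thesis
      using \<open>(x, y) \<notin> boundary_steps Q\<close> boundary_steps_mono[OF U] by blast
  next
    case xy: I
    have "\<not> (\<exists>p\<in>P. \<exists>q\<in>Q. wedge (y - x) (p - x) < 0 \<and> wedge (y - x) (q - x) < 0)"
    proof safe
      fix p q assume pq: "p \<in> P" "q \<in> Q" "wedge (y - x) (p - x) < 0" "wedge (y - x) (q - x) < 0"
      have "closed P" "closed Q" "convex (P \<union> Q)"
        using P Q U
        by (auto simp: lattice_polytope_def polytope_imp_closed polytope_imp_convex)
      then obtain z where z: "z \<in> closed_segment p q" "z \<in> P" "z \<in> Q"
        using segment_meets_Int pq by blast
      then obtain t where t: "0 \<le> t" "t \<le> 1" "z = (1 - t) *\<^sub>R p + t *\<^sub>R q"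
        by (auto simp: in_segment)
      have "wedge (y - x) (z - x) < 0"
      proof (cases "t = 0")
        case False
        with t pq have "t * wedge (y - x) (q - x) < 0" "(1 - t) * wedge (y - x) (p - x) \<le> 0"
          by (auto simp: mult_pos_neg mult_nonneg_nonpos)
        then show ?thesis by (simp add: t(3) wedge_affine)
      qed (use t pq in auto)
      moreover have "0 \<le> wedge (y - x) (z - x)"
        using z xy by (auto simp: boundary_steps_def)
      ultimately show False by simp
    qed
    then have "(\<forall>z\<in>P. 0 \<le> wedge (y - x) (z - x)) \<or> (\<forall>z\<in>Q. 0 \<le> wedge (y - x) (z - x))"
      by (meson not_le)
    with xy \<open>(x, y) \<notin> boundary_steps Q\<close> show ?thesis
      by (auto simp: boundary_steps_def)
  qed
next
  have *: "(x, y) \<in> boundary_steps (A \<union> B) \<union> boundary_steps (A \<inter> B)"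
    if xy: "(x, y) \<in> boundary_steps A" and AB: "lattice_polytope A" "lattice_polytope B"
      "lattice_polytope (A \<union> B)" for x y A B
  proof (cases "\<forall>z\<in>B. 0 \<le> wedge (y - x) (z - x)")
    case True
    with xy show ?thesis by (auto simp: boundary_steps_def)
  next
    case False
    then obtain q where q: "q \<in> B" "wedge (y - x) (q - x) < 0" by force
    have "p \<in> B" if p: "p \<in> A" "wedge (y - x) (p - x) = 0" for p
    proof -
      have "closed A" "closed B" "convex (A \<union> B)"
        using AB by (auto simp: lattice_polytope_def polytope_imp_closed polytope_imp_convex)
      then obtain z where z: "z \<in> closed_segment p q" "z \<in> A" "z \<in> B"
        using segment_meets_Int p q by blast
      then obtain t where t: "0 \<le> t" "t \<le> 1" "z = (1 - t) *\<^sub>R p + t *\<^sub>R q"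
        by (auto simp: in_segment)
      have "0 \<le> wedge (y - x) (z - x)"
        using z xy by (auto simp: boundary_steps_def)
      then have "0 \<le> t * wedge (y - x) (q - x)"
        by (simp add: t(3) wedge_affine p)
      with q(2) t(1) have "t = 0"
        by (simp add: zero_le_mult_iff)
      with z t show ?thesis by simp
    qed
    from this[of x] this[of y] have "x \<in> B" "y \<in> B"
      using xy by (auto simp: boundary_steps_def wedge_def)
    then show ?thesis
      using boundary_steps_mono[OF xy, of "A \<inter> B"] xy by (auto simp: boundary_steps_def)
  qed
  fix x y
  assume "(x, y) \<in> boundary_steps P \<union> boundary_steps Q" "(x, y) \<notin> boundary_steps (P \<inter> Q)"
  then show "(x, y) \<in> boundary_steps (P \<union> Q)"
    using *[of x y P Q] *[of x y Q P] P Q U by (auto simp: Un_commute Int_commute)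
qed

lemma boundary_steps_Int:
  "boundary_steps (P \<union> Q) \<inter> boundary_steps (P \<inter> Q) = boundary_steps P \<inter> boundary_steps Q"
  by (auto simp: boundary_steps_def)

lemma valuation_boundary_tensor: "valuation boundary_tensor"
  unfolding valuation_def
proof (intro conjI allI impI; (elim conjE)?)
  show "boundary_tensor {} = 0"
    by (simp add: boundary_tensor_def boundary_steps_def)
next
  fix P Q :: "(real^2) set"
  assume "lattice_polytope P" "lattice_polytope Q"
    "lattice_polytope (P \<union> Q)" "lattice_polytope (P \<inter> Q)"
  then show "boundary_tensor P + boundary_tensor Q =
      boundary_tensor (P \<union> Q) + boundary_tensor (P \<inter> Q)"
    unfolding boundary_tensor_def
    by (subst (1 2) sum.union_inter[symmetric])
       (simp_all add: finite_boundary_steps boundary_steps_Un boundary_steps_Int)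
qed

section \<open>Invariance properties\<close>

lemma boundary_tensor_image:
  assumes "inj f"
    and lattice: "\<And>x. f x \<in> lattice_points \<longleftrightarrow> x \<in> lattice_points"
    and segment: "\<And>x y. closed_segment (f x) (f y) = f ` closed_segment x y"
    and wedge: "\<And>x y z. wedge (f y - f x) (f z - f x) = wedge (y - x) (z - x)"
  shows "boundary_tensor (f ` P) = (\<Sum>(x, y)\<in>boundary_steps P. tensor_power (f y - f x))"
proof -
  have inj: "f x = f y \<longleftrightarrow> x = y" for x y
    using \<open>inj f\<close> by (auto simp: inj_eq)
  have "closed_segment (f x) (f y) \<inter> lattice_points = f ` (closed_segment x y \<inter> lattice_points)" for x y
    by (auto simp: segment lattice)
  moreover have "{f x, f y} = f ` {x, y}" for x y
    by simp
  ultimately have "closed_segment (f x) (f y) \<inter> lattice_points = {f x, f y} \<longleftrightarrow>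
      closed_segment x y \<inter> lattice_points = {x, y}" for x y
    by (simp only: inj_image_eq_iff[OF \<open>inj f\<close>])
  then have "boundary_steps (f ` P) = map_prod f f ` boundary_steps P"
    by (auto simp: boundary_steps_def wedge inj image_iff)
  moreover have "inj_on (map_prod f f) (boundary_steps P)"
    by (auto simp: inj_on_def inj)
  ultimately show ?thesis
    by (simp add: boundary_tensor_def sum.reindex case_prod_unfold)
qed

lemma translation_invariant_boundary_tensor: "translation_invariant boundary_tensor"
  unfolding translation_invariant_def
proof (intro ballI allI impI)
  fix y :: "real^2" and P :: "(real^2) set"
  assume y: "y \<in> lattice_points"
  have "x + y \<in> lattice_points \<longleftrightarrow> x \<in> lattice_points" for x
  proof
    assume "x + y \<in> lattice_points"
    with y have "\<forall>i. (x + y) $ i - y $ i \<in> \<int>"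
      unfolding lattice_points_def by (blast intro: Ints_diff)
    then show "x \<in> lattice_points" by (simp add: lattice_points_def)
  qed (use y in \<open>auto simp: lattice_points_def\<close>)
  moreover have "closed_segment (u + y) (v + y) = (\<lambda>x. x + y) ` closed_segment u v" for u v
    using closed_segment_translation[of y u v] by (simp add: add.commute)
  ultimately have "boundary_tensor ((\<lambda>x. x + y) ` P) =
      (\<Sum>(u, v)\<in>boundary_steps P. tensor_power ((v + y) - (u + y)))"
    by (intro boundary_tensor_image) auto
  then show "boundary_tensor ((\<lambda>x. x + y) ` P) = boundary_tensor P"
    by (simp add: boundary_tensor_def)
qed

lemma tensor_power_matrix:
  "tensor_apply (tensor_power (A *v x)) v = tensor_apply (tensor_power x) (\<lambda>i. transpose A *v v i)"
proof -
  have "(A *v x) \<bullet> w = x \<bullet> (transpose A *v w)" for w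
    using dot_lmul_matrix[of w A x] by (simp add: inner_commute transpose_matrix_vector)
  then show ?thesis by (simp add: tensor_power.rep_eq)
qed

lemma SL_Z_equivariant_boundary_tensor: "SL_Z_equivariant boundary_tensor"
  unfolding SL_Z_equivariant_def
proof (intro ballI allI impI)
  fix A :: "real^2^2" and P :: "(real^2) set" and v :: "'a \<Rightarrow> real^2"
  assume "A \<in> SL_Z"
  then have int: "A $ i $ j \<in> \<int>" and det: "A $ 1 $ 1 * A $ 2 $ 2 - A $ 1 $ 2 * A $ 2 $ 1 = 1" for i j
    by (auto simp: SL_Z_def det_2)
  have Ax: "(A *v x) $ i = A $ i $ 1 * x $ 1 + A $ i $ 2 * x $ 2" for x i
    by (simp add: matrix_vector_mult_def sum_2)
  \<comment> \<open>Cramer's rule: the inverse of \<open>A\<close> is its adjugate, again an integer matrix.\<close>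
  have inv1: "x $ 1 = A $ 2 $ 2 * (A *v x) $ 1 - A $ 1 $ 2 * (A *v x) $ 2" for x
  proof -
    have "A $ 2 $ 2 * (A *v x) $ 1 - A $ 1 $ 2 * (A *v x) $ 2 =
        (A $ 1 $ 1 * A $ 2 $ 2 - A $ 1 $ 2 * A $ 2 $ 1) * x $ 1"
      unfolding Ax by algebra
    then show ?thesis by (simp add: det)
  qed
  have inv2: "x $ 2 = A $ 1 $ 1 * (A *v x) $ 2 - A $ 2 $ 1 * (A *v x) $ 1" for x
  proof -
    have "A $ 1 $ 1 * (A *v x) $ 2 - A $ 2 $ 1 * (A *v x) $ 1 =
        (A $ 1 $ 1 * A $ 2 $ 2 - A $ 1 $ 2 * A $ 2 $ 1) * x $ 2"
      unfolding Ax by algebra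
    then show ?thesis by (simp add: det)
  qed
  have "inj ((*v) A)"
  proof (rule injI)
    fix x y assume "A *v x = A *v y"
    then show "x = y"
      using inv1[of x] inv1[of y] inv2[of x] inv2[of y] by (simp add: vec_eq_iff forall_2)
  qed
  moreover have "A *v x \<in> lattice_points \<longleftrightarrow> x \<in> lattice_points" for x
  proof
    assume "A *v x \<in> lattice_points"
    then have "(A *v x) $ i \<in> \<int>" for i by (simp add: lattice_points_def)
    with int have "x $ 1 \<in> \<int>" "x $ 2 \<in> \<int>"
      unfolding inv1[of x] inv2[of x] by (blast intro: Ints_diff Ints_mult)+
    then show "x \<in> lattice_points" by (simp add: lattice_points_def forall_2)
  next
    assume "x \<in> lattice_points"
    with int show "A *v x \<in> lattice_points"
      by (simp add: lattice_points_def Ax)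
  qed
  moreover have "closed_segment (A *v x) (A *v y) = (*v) A ` closed_segment x y" for x y
    by (rule closed_segment_linear_image) simp
  moreover have "wedge (A *v y - A *v x) (A *v z - A *v x) = wedge (y - x) (z - x)" for x y z
  proof -
    have "wedge (A *v u) (A *v w) = (A $ 1 $ 1 * A $ 2 $ 2 - A $ 1 $ 2 * A $ 2 $ 1) * wedge u w" for u w
      unfolding wedge_def Ax by algebra
    then show ?thesis
      by (simp add: det flip: matrix_vector_mult_diff_distrib)
  qed
  ultimately have "(boundary_tensor ((*v) A ` P) :: (2, 'a) sym_tensor) =
      (\<Sum>(x, y)\<in>boundary_steps P. tensor_power (A *v y - A *v x))"
    by (rule boundary_tensor_image)
  also have "\<dots> = (\<Sum>(x, y)\<in>boundary_steps P. tensor_power (A *v (y - x)))"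
    by (simp add: matrix_vector_mult_diff_distrib)
  finally have "tensor_apply (boundary_tensor ((*v) A ` P)) v =
      (\<Sum>(x, y)\<in>boundary_steps P. tensor_apply (tensor_power (A *v (y - x))) v)"
    by (simp add: tensor_apply_sum case_prod_unfold)
  then show "tensor_apply (boundary_tensor ((*v) A ` P)) v =
      tensor_apply (boundary_tensor P) (\<lambda>i. transpose A *v v i)"
    by (simp only: boundary_tensor_def tensor_apply_sum tensor_power_matrix case_prod_unfold)
qed

section \<open>The standard triangle\<close>

definition std_triangle :: "real \<Rightarrow> (real^2) set" where
  "std_triangle k = {x. 0 \<le> x $ 1 \<and> 0 \<le> x $ 2 \<and> x $ 1 + x $ 2 \<le> k}"

lemma vec2_eq_iff: "(x :: real^2) = y \<longleftrightarrow> x $ 1 = y $ 1 \<and> x $ 2 = y $ 2"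
  by (simp add: vec_eq_iff forall_2)

lemma std_triangle_eq_hull:
  "std_triangle 1 = convex hull {0, vector [1, 0], vector [0, 1]}"
proof (intro equalityI subsetI)
  fix x assume "x \<in> std_triangle 1"
  then show "x \<in> convex hull {0, vector [1, 0], vector [0, 1]}"
    unfolding convex_hull_3 std_triangle_def mem_Collect_eq
    by (intro exI[of _ "1 - x $ 1 - x $ 2"] exI[of _ "x $ 1"] exI[of _ "x $ 2"])
       (auto simp: vec2_eq_iff)
qed (auto simp: convex_hull_3 std_triangle_def)

lemma lattice_polytope_std_triangle: "lattice_polytope (std_triangle 1)"
  unfolding lattice_polytope_def std_triangle_eq_hull
proof
  show "{x. x extreme_point_of convex hull {0, vector [1, 0], vector [0, 1]}}
      \<subseteq> (lattice_points :: (real^2) set)"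
    using extreme_point_of_convex_hull by (fastforce simp: lattice_points_def forall_2)
qed (simp add: polytope_convex_hull)

lemma scale_std_triangle: "(\<lambda>x. real k *\<^sub>R x) ` std_triangle 1 = std_triangle (real k)"
proof (cases "k = 0")
  case True
  have "x \<in> std_triangle 0 \<longleftrightarrow> x = 0" for x
    by (auto simp: std_triangle_def vec2_eq_iff)
  moreover have "0 \<in> std_triangle 1"
    by (simp add: std_triangle_def)
  ultimately show ?thesis using True by auto
next
  case False
  have "x \<in> (\<lambda>x. real k *\<^sub>R x) ` std_triangle 1" if "x \<in> std_triangle (real k)" for x
    using that False
    by (intro image_eqI[of _ _ "(1 / real k) *\<^sub>R x"])
       (auto simp: std_triangle_def field_simps)
  moreover have "real k *\<^sub>R x \<in> std_triangle (real k)" if "x \<in> std_triangle 1" for x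
    using that mult_left_mono[of "x $ 1 + x $ 2" 1 "real k"]
    by (auto simp: std_triangle_def algebra_simps)
  ultimately show ?thesis by blast
qed

text \<open>
  Slicing by \<open>s = x\<^sub>1 + x\<^sub>2\<close> makes the sum over the dilated triangle an iterated partial sum of
  a sequence, so that its degree can be bounded in two separate steps.
\<close>

lemma std_triangle_lattice_points:
  "std_triangle (real k) \<inter> lattice_points =
     (\<lambda>(s, i). vector [real i, real (s - i)]) ` (SIGMA s:{..k}. {..s})"
proof (intro equalityI subsetI)
  fix x assume x: "x \<in> std_triangle (real k) \<inter> lattice_points"
  then have "x $ 1 \<in> \<int>" "x $ 2 \<in> \<int>"
    by (auto simp: lattice_points_def)
  then obtain a b where ab: "x $ 1 = of_int a" "x $ 2 = of_int b"
    by (elim Ints_cases)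
  with x have "0 \<le> a" "0 \<le> b" "a + b \<le> int k"
    by (auto simp: std_triangle_def simp flip: of_int_add)
  with ab show "x \<in> (\<lambda>(s, i). vector [real i, real (s - i)]) ` (SIGMA s:{..k}. {..s})"
    by (intro image_eqI[of _ _ "(nat (a + b), nat a)"])
       (auto simp: vec2_eq_iff nat_add_distrib)
qed (auto simp: std_triangle_def lattice_points_def forall_2)

lemma sum_std_triangle:
  "(\<Sum>x\<in>std_triangle (real k) \<inter> lattice_points. f x) =
     (\<Sum>s\<le>k. \<Sum>i\<le>s. f (vector [real i, real (s - i)]))"
proof -
  have "inj_on (\<lambda>(s, i). vector [real i, real (s - i)] :: real^2) (SIGMA s:{..k}. {..s})"
    by (auto simp: inj_on_def vec2_eq_iff)
  then show ?thesis
    by (simp add: std_triangle_lattice_points sum.reindex sum.Sigma case_prod_unfold del: of_nat_diff)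
qed

lemma std_triangle_1_lattice_points:
  "std_triangle 1 \<inter> lattice_points = {0, vector [1, 0], vector [0, 1]}"
  using std_triangle_lattice_points[of 1]
  by (auto simp: vec2_eq_iff atMost_Suc image_iff)

lemma boundary_steps_std_triangle:
  "boundary_steps (std_triangle 1) =
     {(0, vector [1, 0]), (vector [1, 0], vector [0, 1]), (vector [0, 1], 0)}"
proof (rule subset_antisym; rule subrelI)
  fix x y assume xy: "(x, y) \<in> boundary_steps (std_triangle 1)"
  from xy have "x \<in> std_triangle 1 \<inter> lattice_points" "y \<in> std_triangle 1 \<inter> lattice_points"
    by (auto simp: boundary_steps_def)
  moreover have "x \<noteq> y" and left: "\<And>z. z \<in> std_triangle 1 \<Longrightarrow> 0 \<le> wedge (y - x) (z - x)"
    using xy by (auto simp: boundary_steps_def)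
  moreover have "0 \<in> std_triangle 1" "vector [1, 0] \<in> std_triangle 1" "vector [0, 1] \<in> std_triangle 1"
    by (auto simp: std_triangle_def)
  note this[THEN left]
  ultimately show "(x, y) \<in> {(0, vector [1, 0]), (vector [1, 0], vector [0, 1]), (vector [0, 1], 0)}"
    unfolding std_triangle_1_lattice_points by (auto simp: wedge_def)
next
  have "closed_segment x y \<inter> lattice_points = {x, y}"
    if xy: "x \<in> {0, vector [1, 0], vector [0, 1]}" "y \<in> {0, vector [1, 0], vector [0, 1]}" for x y :: "real^2"
  proof -
    have "{x, y} \<subseteq> std_triangle 1 \<inter> lattice_points"
      using xy by (simp add: std_triangle_1_lattice_points)
    moreover have "closed_segment x y \<subseteq> std_triangle 1"
      using calculation by (intro closed_segment_subset) (auto simp: std_triangle_eq_hull)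
    then have "closed_segment x y \<inter> lattice_points \<subseteq> {0, vector [1, 0], vector [0, 1]}"
      unfolding std_triangle_1_lattice_points[symmetric] by blast
    moreover have "z \<in> {x, y}" if "z \<in> closed_segment x y" "z \<in> {0, vector [1, 0], vector [0, 1]}" for z
      using xy that by (auto simp: in_segment vec2_eq_iff)
    ultimately show ?thesis by blast
  qed
  note cons = this
  fix x y :: "real^2"
  assume "(x, y) \<in> {(0, vector [1, 0]), (vector [1, 0], vector [0, 1]), (vector [0, 1], 0)}"
  moreover from this cons[of x y] have "closed_segment x y \<inter> lattice_points = {x, y}" by auto
  ultimately show "(x, y) \<in> boundary_steps (std_triangle 1)"
    by (auto simp: boundary_steps_def std_triangle_def wedge_def vec2_eq_iff)
qed

lemma tensor_power_const:
  "tensor_apply (tensor_power x :: (2, 'r::finite) sym_tensor) (\<lambda>_. v) = (x \<bullet> v) ^ CARD('r)"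
  by (simp add: tensor_power.rep_eq)

lemma boundary_tensor_std_triangle:
  "tensor_apply (boundary_tensor (std_triangle 1) :: (2, 'r::finite) sym_tensor) (\<lambda>_. vector [a, b]) =
     a ^ CARD('r) + (b - a) ^ CARD('r) + (- b) ^ CARD('r)"
proof -
  have "0 \<noteq> (vector [0, 1] :: real^2)" "0 \<noteq> (vector [1, 0] :: real^2)"
    by (auto simp: vec2_eq_iff)
  then show ?thesis
    unfolding boundary_tensor_def boundary_steps_std_triangle tensor_apply_sum
    by (simp add: tensor_power_const inner_vec_def sum_2 vec2_eq_iff)
qed

section \<open>Polynomial sequences\<close>

definition poly_seq :: "nat \<Rightarrow> (nat \<Rightarrow> real) \<Rightarrow> bool" where
  "poly_seq d f \<longleftrightarrow> (\<exists>p. degree p \<le> d \<and> (\<forall>k. f k = poly p (real k)))"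

lemma poly_seq_mono: "poly_seq d f \<Longrightarrow> d \<le> e \<Longrightarrow> poly_seq e f"
  unfolding poly_seq_def by (meson order_trans)

lemma poly_seq_power: "poly_seq d (\<lambda>k. real k ^ d)"
  unfolding poly_seq_def
  by (intro exI[of _ "monom 1 d"]) (simp add: poly_monom degree_monom_eq)

lemma poly_seq_mult:
  assumes "poly_seq d f" "poly_seq e g"
  shows "poly_seq (d + e) (\<lambda>k. f k * g k)"
proof -
  obtain p q where "degree p \<le> d" "\<forall>k. f k = poly p (real k)"
      "degree q \<le> e" "\<forall>k. g k = poly q (real k)"
    using assms unfolding poly_seq_def by blast
  moreover from this have "degree (p * q) \<le> d + e"
    using degree_mult_le[of p q] by linarith
  ultimately show ?thesis
    unfolding poly_seq_def by (intro exI[of _ "p * q"]) simp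
qed

lemma poly_seq_cmult: "poly_seq d f \<Longrightarrow> poly_seq d (\<lambda>k. c * f k)"
  using poly_seq_mult[of 0 "\<lambda>_. c" d f]
  by (auto simp: poly_seq_def intro!: exI[of _ "[:c:]"] elim!: meta_mp)

lemma poly_seq_sum:
  assumes "\<And>x. x \<in> A \<Longrightarrow> poly_seq d (f x)"
  shows "poly_seq d (\<lambda>k. \<Sum>x\<in>A. f x k)"
proof (cases "finite A")
  case True
  from assms obtain p where p: "\<And>x. x \<in> A \<Longrightarrow> degree (p x) \<le> d \<and> (\<forall>k. f x k = poly (p x) (real k))"
    unfolding poly_seq_def by metis
  show ?thesis
    unfolding poly_seq_def
  proof (intro exI conjI allI)
    show "degree (\<Sum>x\<in>A. p x) \<le> d"
      using True p by (intro degree_sum_le) auto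
    show "(\<Sum>x\<in>A. f x k) = poly (\<Sum>x\<in>A. p x) (real k)" for k
      using p by (simp add: poly_sum)
  qed
qed (auto simp: poly_seq_def intro: exI[of _ 0])

lemma poly_seq_diff:
  assumes "poly_seq d f" "poly_seq d g"
  shows "poly_seq d (\<lambda>k. f k - g k)"
  using assms unfolding poly_seq_def by (metis degree_diff_le poly_diff)

text \<open>
  Telescoping \<open>(i + 1) ^ (m + 1) - i ^ (m + 1)\<close> expresses the sum of \<open>m\<close>-th powers through
  sums of lower powers.
\<close>

lemma poly_seq_sum_powers: "poly_seq (m + 1) (\<lambda>k. \<Sum>i\<le>k. real i ^ m)"
proof (induction m rule: less_induct)
  case (less m)
  define S where "S = (\<lambda>j k. \<Sum>i\<le>k. real i ^ j)"
  have tele: "real (k + 1) ^ (m + 1) = (\<Sum>j\<le>m. real ((m + 1) choose j) * S j k)" for k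
  proof -
    have "real (i + 1) ^ (m + 1) - real i ^ (m + 1) = (\<Sum>j\<le>m. real ((m + 1) choose j) * real i ^ j)" for i
      using binomial_ring[of "real i" 1 "m + 1"] by (simp add: add.commute)
    then have "(\<Sum>i\<le>k. \<Sum>j\<le>m. real ((m + 1) choose j) * real i ^ j) =
        (\<Sum>i\<le>k. real (Suc i) ^ (m + 1) - real i ^ (m + 1))"
      by (simp add: add.commute)
    also have "\<dots> = real (k + 1) ^ (m + 1)"
      using sum_telescope[of "\<lambda>i. - (real i ^ (m + 1))" k] by (simp add: algebra_simps)
    finally show ?thesis
      by (simp add: S_def sum_distrib_left sum.swap[of _ "{..m}"])
  qed
  have "S m = (\<lambda>k. 1 / real (m + 1) *
      (real (k + 1) ^ (m + 1) - (\<Sum>j<m. real ((m + 1) choose j) * S j k)))"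
  proof
    fix k
    show "S m k = 1 / real (m + 1) *
        (real (k + 1) ^ (m + 1) - (\<Sum>j<m. real ((m + 1) choose j) * S j k))"
      using tele[of k] by (simp add: flip: lessThan_Suc_atMost)
  qed
  moreover have "poly_seq (m + 1) (\<lambda>k. real (k + 1) ^ (m + 1))"
    unfolding poly_seq_def
    by (intro exI[of _ "[:1, 1:] ^ (m + 1)"] conjI allI order_trans[OF degree_power_le])
       (simp_all add: algebra_simps)
  moreover have "poly_seq (m + 1) (S j)" if "j < m" for j
    using less[OF that] poly_seq_mono that by (fastforce simp: S_def)
  ultimately have "poly_seq (m + 1) (S m)"
    by (simp only:) (intro poly_seq_cmult poly_seq_diff poly_seq_sum; simp)
  then show ?case by (simp add: S_def)
qed

lemma poly_seq_partial_sums: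
  assumes "poly_seq d f"
  shows "poly_seq (d + 1) (\<lambda>k. \<Sum>i\<le>k. f i)"
proof -
  obtain p where p: "degree p \<le> d" "\<And>k. f k = poly p (real k)"
    using assms unfolding poly_seq_def by blast
  have "(\<Sum>i\<le>k. f i) = (\<Sum>j\<le>degree p. coeff p j * (\<Sum>i\<le>k. real i ^ j))" for k
    by (simp add: p(2) poly_altdef sum_distrib_left sum.swap[of _ "{..k}"])
  moreover have "poly_seq (d + 1) (\<lambda>k. \<Sum>i\<le>k. real i ^ j)" if "j \<le> degree p" for j
    using poly_seq_mono[OF poly_seq_sum_powers[of j]] that p(1) by simp
  ultimately show ?thesis
    by (simp only:) (intro poly_seq_sum poly_seq_cmult; simp)
qed

text \<open>
  At \<open>x = (i, s - i)\<close> each factor of the tensor power is linear in \<open>(s, i)\<close>, so the product expands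
  into monomials of total degree \<open>r\<close>; summing over \<open>i\<close> and then over \<open>s\<close> raises the degree by one
  each time.
\<close>

lemma poly_seq_moment:
  "poly_seq (CARD('r) + 2)
     (\<lambda>k. tensor_apply (\<Sum>x\<in>std_triangle (real k) \<inter> lattice_points. tensor_power x :: (2, 'r::finite) sym_tensor) v)"
proof -
  let ?U = "UNIV :: 'r set"
  define c where "c X = (\<Prod>r\<in>X. v r $ 1 - v r $ 2) * (\<Prod>r\<in>?U - X. v r $ 2)" for X
  have "tensor_apply (tensor_power (vector [real i, real (s - i)])) v =
      (\<Sum>X\<in>Pow ?U. c X * (real s ^ card (?U - X) * real i ^ card X))" if "i \<le> s" for i s
  proof -
    have "tensor_apply (tensor_power (vector [real i, real (s - i)])) v =
        (\<Prod>r\<in>?U. real i * (v r $ 1 - v r $ 2) + real s * v r $ 2)"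
      using that by (simp add: tensor_power.rep_eq inner_vec_def sum_2 algebra_simps)
    also have "\<dots> = (\<Sum>X\<in>Pow ?U. c X * (real s ^ card (?U - X) * real i ^ card X))"
      by (simp add: prod_add prod.distrib c_def mult_ac)
    finally show ?thesis .
  qed
  then have "tensor_apply (\<Sum>x\<in>std_triangle (real k) \<inter> lattice_points. tensor_power x) v =
      (\<Sum>s\<le>k. \<Sum>i\<le>s. \<Sum>X\<in>Pow ?U. c X * (real s ^ card (?U - X) * real i ^ card X))" for k
    by (simp add: sum_std_triangle tensor_apply_sum del: of_nat_diff)
  also have "(\<Sum>s\<le>k. \<Sum>i\<le>s. \<Sum>X\<in>Pow ?U. c X * (real s ^ card (?U - X) * real i ^ card X)) =
     (\<Sum>s\<le>k. \<Sum>X\<in>Pow ?U. c X * (real s ^ card (?U - X) * (\<Sum>i\<le>s. real i ^ card X)))" for k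
    by (subst sum.swap) (simp add: sum_distrib_left)
  moreover have "poly_seq (CARD('r) + 1) (\<lambda>s. real s ^ card (?U - X) * (\<Sum>i\<le>s. real i ^ card X))" for X
  proof -
    have "card (?U - X) + card X = CARD('r)"
      by (metis add.commute card_Diff_subset card_mono finite le_add_diff_inverse subset_UNIV)
    then show ?thesis
      using poly_seq_mult[OF poly_seq_power poly_seq_sum_powers, of "card (?U - X)" "card X"]
      by (simp add: add.assoc[symmetric])
  qed
  then have "poly_seq (CARD('r) + 1 + 1)
      (\<lambda>k. \<Sum>s\<le>k. \<Sum>X\<in>Pow ?U. c X * (real s ^ card (?U - X) * (\<Sum>i\<le>s. real i ^ card X)))"
    by (intro poly_seq_partial_sums poly_seq_sum poly_seq_cmult)
  ultimately show ?thesis by simp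
qed

text \<open>
  Lagrange interpolation at \<open>0, ..., d\<close>. The same numbers \<open>l\<close> serve all sequences \<open>f\<close>;
  this is what lets the formula pass from evaluated tensors to the tensors themselves.
\<close>

lemma poly_seq_interpolation:
  "\<exists>l :: nat \<Rightarrow> nat \<Rightarrow> real. \<forall>f. poly_seq d f \<longrightarrow>
     (\<forall>k. f k = (\<Sum>j\<le>d. real k ^ j * (\<Sum>n\<le>d. l n j * f n)))"
proof -
  define L where "L n = smult (1 / (\<Prod>m\<in>{..d} - {n}. real n - real m)) (\<Prod>m\<in>{..d} - {n}. [:- real m, 1:])" for n
  have deg_L: "degree (L n) \<le> d" if "n \<le> d" for n
  proof -
    have "degree (\<Prod>m\<in>{..d} - {n}. [:- real m, 1:]) \<le> (\<Sum>m\<in>{..d} - {n}. 1)"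
      by (rule order_trans[OF degree_prod_sum_le]) (auto intro!: sum_mono)
    also have "\<dots> = d" using that by simp
    finally show ?thesis
      unfolding L_def using degree_smult_le order_trans by blast
  qed
  have L: "poly (L n) (real m) = (if m = n then 1 else 0)" if "n \<le> d" "m \<le> d" for n m
    using that by (auto simp: L_def poly_prod)
  have "f k = (\<Sum>j\<le>d. real k ^ j * (\<Sum>n\<le>d. coeff (L n) j * f n))" if f: "poly_seq d f" for f k
  proof -
    obtain p where p: "degree p \<le> d" "\<And>k. f k = poly p (real k)"
      using f unfolding poly_seq_def by blast
    let ?q = "\<Sum>n\<le>d. smult (f n) (L n)"
    have deg: "degree ?q \<le> d"
      by (intro degree_sum_le) (auto intro: order_trans[OF degree_smult_le] deg_L)
    have "p = ?q"
    proof (rule poly_eqI_degree[of "real ` {..d}"])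
      fix x assume "x \<in> real ` {..d}"
      then show "poly p x = poly ?q x"
        by (auto simp: poly_sum L p(2) if_distrib[of "(*) _"] cong: if_cong)
    qed (use deg p in \<open>auto simp: card_image\<close>)
    then have "f k = poly ?q (real k)" by (simp add: p(2))
    also have "\<dots> = (\<Sum>j\<le>d. coeff ?q j * real k ^ j)"
      unfolding poly_altdef using deg
      by (intro sum.mono_neutral_left) (auto simp: coeff_eq_0)
    finally show ?thesis
      by (simp add: coeff_sum mult_ac)
  qed
  then show ?thesis
    by (intro exI[of _ "\<lambda>n j. coeff (L n) j"]) blast
qed

section \<open>Ehrhart tensors of the standard triangle\<close>

lemma power_sum_coeffs_unique:
  fixes a b :: "nat \<Rightarrow> real"
  assumes "\<And>k::nat. (\<Sum>j=1..d. real k ^ j * a j) = (\<Sum>j=1..d. real k ^ j * b j)" "j \<in> {1..d}"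
  shows "a j = b j"
proof -
  define p where "p a = (\<Sum>j=1..d. monom (a j) j)" for a :: "nat \<Rightarrow> real"
  have "poly (p a - p b) (real k) = 0" for k
    using assms(1)[of k] by (simp add: p_def poly_sum poly_monom mult.commute)
  then have "range real \<subseteq> {x. poly (p a - p b) x = 0}"
    by auto
  moreover have "infinite (range real)"
    by (simp add: range_inj_infinite inj_on_def)
  ultimately have "p a - p b = 0"
    using poly_roots_finite finite_subset by blast
  then have "coeff (p a) j = coeff (p b) j" by simp
  with assms(2) show ?thesis by (simp add: p_def coeff_sum)
qed

lemma tensor_apply_discrete_moment_std_triangle:
  "tensor_apply (discrete_moment_tensor ((\<lambda>x. real k *\<^sub>R x) ` std_triangle 1) :: (2, 'r::finite) sym_tensor) v =
     1 / fact CARD('r) *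
       tensor_apply (\<Sum>x\<in>std_triangle (real k) \<inter> lattice_points. tensor_power x :: (2, 'r) sym_tensor) v"
  by (simp add: discrete_moment_tensor_def scale_std_triangle scaleR_sym_tensor.rep_eq)

text \<open>
  The expansion starts at \<open>k ^ 1\<close> because the only lattice point of \<open>0 T\<close> is the origin, whose
  tensor power vanishes.
\<close>

lemma ehrhart_expansion_std_triangle:
  "\<forall>k::nat. (discrete_moment_tensor ((\<lambda>x. real k *\<^sub>R x) ` std_triangle 1) :: (2, 'r::finite) sym_tensor) =
     (\<Sum>j = 1..CARD(2) + CARD('r). real k ^ j *\<^sub>R ehrhart_tensor j (std_triangle 1))"
  (is "\<forall>k. ?M k = _")
proof -
  define d where "d = CARD(2) + CARD('r)"
  let ?is_expansion = "\<lambda>c. \<forall>k. ?M k = (\<Sum>j = 1..d. real k ^ j *\<^sub>R c j)"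
  obtain l where l: "\<And>f k. poly_seq d f \<Longrightarrow> f k = (\<Sum>j\<le>d. real k ^ j * (\<Sum>n\<le>d. l n j * f n))"
    using poly_seq_interpolation[of d] by blast
  define c where "c j = (\<Sum>n\<le>d. l n j *\<^sub>R ?M n)" for j
  have poly: "poly_seq d (\<lambda>k. tensor_apply (?M k) v)" for v
    unfolding tensor_apply_discrete_moment_std_triangle
    using poly_seq_moment[where 'r = 'r] by (intro poly_seq_cmult) (simp add: d_def)
  have all: "?M k = (\<Sum>j\<le>d. real k ^ j *\<^sub>R c j)" for k
  proof -
    have "tensor_apply (?M k) v = tensor_apply (\<Sum>j\<le>d. real k ^ j *\<^sub>R c j) v" for v
      by (subst l[OF poly]) (simp add: tensor_apply_sum scaleR_sym_tensor.rep_eq c_def)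
    then show ?thesis
      by (simp add: tensor_apply_inject[symmetric] fun_eq_iff)
  qed
  have "tensor_apply (?M 0) v = 0" for v
    unfolding tensor_apply_discrete_moment_std_triangle tensor_apply_sum sum_std_triangle
    by (simp add: tensor_power.rep_eq inner_vec_def sum_2 power_0_left)
  then have "?M 0 = 0"
    by (simp add: tensor_apply_inject[symmetric] fun_eq_iff zero_sym_tensor.rep_eq)
  moreover have split: "(\<Sum>j\<le>d. real k ^ j *\<^sub>R c j) = c 0 + (\<Sum>j=1..d. real k ^ j *\<^sub>R c j)" for k
    by (simp add: sum.atMost_shift sum.atLeast1_atMost_eq lessThan_Suc_atMost atMost_atLeast0
        sum.atLeast_Suc_atMost del: sum.cl_ivl_Suc)
  moreover have "(\<Sum>j=1..d. real 0 ^ j *\<^sub>R c j) = 0"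
    by (intro sum.neutral) auto
  ultimately have "c 0 = 0"
    using all[of 0] split[of 0] by (simp only: add_0_right)
  with all split have c: "?is_expansion c" by simp
  have unique: "b j = c j" if "?is_expansion b" "j \<in> {1..d}" for b j
  proof -
    have "tensor_apply (b j) v = tensor_apply (c j) v" for v
    proof (rule power_sum_coeffs_unique[OF _ that(2)])
      fix k
      have "(\<Sum>j = 1..d. real k ^ j *\<^sub>R b j) = (\<Sum>j = 1..d. real k ^ j *\<^sub>R c j)"
        using that(1) c by metis
      then have "tensor_apply (\<Sum>j = 1..d. real k ^ j *\<^sub>R b j) v = tensor_apply (\<Sum>j = 1..d. real k ^ j *\<^sub>R c j) v"
        by simp
      then show "(\<Sum>j = 1..d. real k ^ j * tensor_apply (b j) v) = (\<Sum>j = 1..d. real k ^ j * tensor_apply (c j) v)"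
        by (simp only: tensor_apply_sum scaleR_sym_tensor.rep_eq)
    qed
    then show ?thesis
      by (simp add: tensor_apply_inject[symmetric] fun_eq_iff)
  qed
  have "ehrhart_tensor j (std_triangle 1) = c j" if "j \<in> {1..d}" for j
    unfolding ehrhart_tensor_def d_def[symmetric]
  proof (rule the_equality)
    show "\<exists>b. c j = b j \<and> ?is_expansion b" using c by blast
  qed (use unique that in blast)
  with c show ?thesis unfolding d_def[symmetric] by simp
qed

text \<open>The reflection that maps every dilate of the standard triangle to itself.\<close>

definition swap_coords :: "real^2 \<Rightarrow> real^2" where
  "swap_coords x = vector [x $ 2, x $ 1]"

lemma moment_std_triangle_swap_coords:
  "tensor_apply (\<Sum>x\<in>std_triangle k \<inter> lattice_points. tensor_power x) (\<lambda>i. swap_coords (v i)) =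
   tensor_apply (\<Sum>x\<in>std_triangle k \<inter> lattice_points. tensor_power x) v"
  unfolding tensor_apply_sum
proof (rule sum.reindex_bij_witness[of _ swap_coords swap_coords])
  fix x :: "real^2"
  have "x \<bullet> swap_coords w = swap_coords x \<bullet> w" for w
    by (simp add: swap_coords_def inner_vec_def sum_2)
  then show "tensor_apply (tensor_power (swap_coords x)) v = tensor_apply (tensor_power x) (\<lambda>i. swap_coords (v i))"
    by (simp add: tensor_power.rep_eq)
qed (auto simp: swap_coords_def vec2_eq_iff std_triangle_def lattice_points_def forall_2)

text \<open>The symmetry of the moments of all \<open>k T\<close> passes to the coefficients of the expansion.\<close>

lemma ehrhart_tensor_std_triangle_swap_coords:
  fixes v :: "'r::finite \<Rightarrow> real^2"
  assumes "j \<in> {1..CARD(2) + CARD('r)}"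
  shows "tensor_apply (ehrhart_tensor j (std_triangle 1)) (\<lambda>i. swap_coords (v i)) =
     tensor_apply (ehrhart_tensor j (std_triangle 1)) v"
proof (rule power_sum_coeffs_unique[OF _ assms])
  fix k
  have "tensor_apply (\<Sum>j = 1..CARD(2) + CARD('r). real k ^ j *\<^sub>R ehrhart_tensor j (std_triangle 1)) (\<lambda>i. swap_coords (v i)) =
      tensor_apply (\<Sum>j = 1..CARD(2) + CARD('r). real k ^ j *\<^sub>R ehrhart_tensor j (std_triangle 1)) v"
    unfolding ehrhart_expansion_std_triangle[rule_format, symmetric]
      tensor_apply_discrete_moment_std_triangle moment_std_triangle_swap_coords ..
  then show "(\<Sum>j = 1..CARD(2) + CARD('r). real k ^ j * tensor_apply (ehrhart_tensor j (std_triangle 1)) (\<lambda>i. swap_coords (v i))) =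
      (\<Sum>j = 1..CARD(2) + CARD('r). real k ^ j * tensor_apply (ehrhart_tensor j (std_triangle 1)) v)"
    by (simp only: tensor_apply_sum scaleR_sym_tensor.rep_eq)
qed

section \<open>A valuation outside the span of the Ehrhart tensors\<close>

theorem mainTheorem5:
  "\<exists>N :: (real^2) set \<Rightarrow> (2, 9) sym_tensor.
     valuation N \<and> SL_Z_equivariant N \<and> translation_invariant N \<and>
     \<not> (\<exists>c :: nat \<Rightarrow> real. \<forall>P. lattice_polytope P \<longrightarrow>
           N P = (\<Sum>i = 1..11. c i *\<^sub>R ehrhart_tensor i P))"
proof (intro exI conjI notI)
  show "valuation (boundary_tensor :: (real^2) set \<Rightarrow> (2, 9) sym_tensor)"
    by (rule valuation_boundary_tensor)
  show "SL_Z_equivariant (boundary_tensor :: (real^2) set \<Rightarrow> (2, 9) sym_tensor)"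
    by (rule SL_Z_equivariant_boundary_tensor)
  show "translation_invariant (boundary_tensor :: (real^2) set \<Rightarrow> (2, 9) sym_tensor)"
    by (rule translation_invariant_boundary_tensor)
  assume "\<exists>c :: nat \<Rightarrow> real. \<forall>P. lattice_polytope P \<longrightarrow>
      (boundary_tensor P :: (2, 9) sym_tensor) = (\<Sum>i = 1..11. c i *\<^sub>R ehrhart_tensor i P)"
  then obtain c where c: "(boundary_tensor (std_triangle 1) :: (2, 9) sym_tensor) =
      (\<Sum>i = 1..11. c i *\<^sub>R ehrhart_tensor i (std_triangle 1))"
    using lattice_polytope_std_triangle by blast
  \<comment> \<open>The boundary tensor takes the value \<open>1 + 1 - 2 ^ 9\<close> at \<open>(1, 2)\<close> and its negative at \<open>(2, 1)\<close>.\<close>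
  define v :: "9 \<Rightarrow> real^2" where "v = (\<lambda>_. vector [1, 2])"
  have "tensor_apply (boundary_tensor (std_triangle 1)) (\<lambda>i. swap_coords (v i)) =
      tensor_apply (boundary_tensor (std_triangle 1)) v"
    unfolding c tensor_apply_sum scaleR_sym_tensor.rep_eq
    by (intro sum.cong arg_cong[of _ _ "(*) _"] ehrhart_tensor_std_triangle_swap_coords) auto
  moreover have "(\<lambda>i. swap_coords (v i)) = (\<lambda>_. vector [2, 1])"
    by (simp add: v_def swap_coords_def)
  ultimately show False
    by (simp add: v_def boundary_tensor_std_triangle)
qed

end
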